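(* Let $\mathfrak{L}$ be a symmetric Leibniz algebra over a field $\mathbb{F}$. Then the following statements are equivalent: (i) $\mathfrak{L}$ is solvable. (ii) $\mathfrak{L}_{\mathrm{Lie}}$ is solvable. (iii) $\mathfrak{L}/C(\mathfrak{L})$ is solvable. (iv) $L(\mathfrak{L})$ is solvable. (v) $R(\mathfrak{L})$ is solvable. (vi) $\mathrm{Lie}(\mathfrak{L})$ is solvable.
   Context: An algebra over a field $\mathbb{F}$ is an $\mathbb{F}$-vector space (of arbitrary dimension) with a bilinear multiplication $(x,y)\mapsto xy$, not assumed associative. A symmetric Leibniz algebra is an algebra $\mathfrak{L}$ satisfying both $x(yz)=(xy)z+y(xz)$ and $(xy)z=(xz)y+x(yz)$ for all $x,y,z\in\mathfrak{L}$. For an algebra $\mathfrak{A}$, the derived series is $\mathfrak{A}^{(0)}:=\mathfrak{A}$, $\mathfrak{A}^{(n+1)}:=\mathfrak{A}^{(n)}\mathfrak{A}^{(n)}$, where a product of two subspaces denotes the linear span of all products of their elements; $\mathfrak{A}$ is solvable if $\mathfrak{A}^{(r)}=0$ for some non-negative integer $r$ (Lie algebras are regarded as algebras via their bracket). The Leibniz kernel $\mathrm{Leib}(\mathfrak{L})$ is the $\mathbb{F}$-span of $\{x^2=xx\mid x\in\mathfrak{L}\}$; it is a (two-sided) ideal, and $\mathfrak{L}_{\mathrm{Lie}}:=\mathfrak{L}/\mathrm{Leib}(\mathfrak{L})$ is the canonical Lie algebra associated to $\mathfrak{L}$. The center is $C(\mathfrak{L}):=\{c\in\mathfrak{L}\mid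 cx=0=xc\text{ for all }x\in\mathfrak{L}\}$, which is an ideal. For $a\in\mathfrak{L}$ let $L_a(x):=ax$ and $R_a(x):=xa$; put $L(\mathfrak{L}):=\{L_a\mid a\in\mathfrak{L}\}$ and $R(\mathfrak{L}):=\{R_a\mid a\in\mathfrak{L}\}$, which are Lie subalgebras of $\mathfrak{gl}(\mathfrak{L})$ (all linear operators on $\mathfrak{L}$ with the commutator bracket). The Lie multiplication algebra $\mathrm{Lie}(\mathfrak{L})$ is the Lie subalgebra of $\mathfrak{gl}(\mathfrak{L})$ generated by $L(\mathfrak{L})\cup R(\mathfrak{L})$. *)

theory Defs
  imports "HOL-Algebra.Module" "HOL-Algebra.QuotRing"
begin

text \<open>
  Algebras are carried by the library record \<^type>\<open>module_ext\<close>: its field \<^const>\<open>mult\<close> is the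
  (not necessarily associative) product. Its field \<^const>\<open>one\<close> plays no role and is never
  constrained.
\<close>

locale nonassoc_algebra = F?: field F + module F A
  for F (structure) and A (structure) +
  assumes prod_closed:
      "\<lbrakk>x \<in> carrier A; y \<in> carrier A\<rbrakk> \<Longrightarrow> x \<otimes>\<^bsub>A\<^esub> y \<in> carrier A"
    and prod_add_left:
      "\<lbrakk>x \<in> carrier A; y \<in> carrier A; z \<in> carrier A\<rbrakk> \<Longrightarrow>
        (x \<oplus>\<^bsub>A\<^esub> y) \<otimes>\<^bsub>A\<^esub> z = (x \<otimes>\<^bsub>A\<^esub> z) \<oplus>\<^bsub>A\<^esub> (y \<otimes>\<^bsub>A\<^esub> z)"
    and prod_add_right:
      "\<lbrakk>x \<in> carrier A; y \<in> carrier A; z \<in> carrier A\<rbrakk> \<Longrightarrow>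
        x \<otimes>\<^bsub>A\<^esub> (y \<oplus>\<^bsub>A\<^esub> z) = (x \<otimes>\<^bsub>A\<^esub> y) \<oplus>\<^bsub>A\<^esub> (x \<otimes>\<^bsub>A\<^esub> z)"
    and prod_smult_left:
      "\<lbrakk>a \<in> carrier F; x \<in> carrier A; y \<in> carrier A\<rbrakk> \<Longrightarrow>
        (a \<odot>\<^bsub>A\<^esub> x) \<otimes>\<^bsub>A\<^esub> y = a \<odot>\<^bsub>A\<^esub> (x \<otimes>\<^bsub>A\<^esub> y)"
    and prod_smult_right:
      "\<lbrakk>a \<in> carrier F; x \<in> carrier A; y \<in> carrier A\<rbrakk> \<Longrightarrow>
        x \<otimes>\<^bsub>A\<^esub> (a \<odot>\<^bsub>A\<^esub> y) = a \<odot>\<^bsub>A\<^esub> (x \<otimes>\<^bsub>A\<^esub> y)"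

locale symmetric_leibniz_algebra = nonassoc_algebra F L
  for F (structure) and L (structure) +
  assumes left_leibniz:
      "\<lbrakk>x \<in> carrier L; y \<in> carrier L; z \<in> carrier L\<rbrakk> \<Longrightarrow>
        x \<otimes>\<^bsub>L\<^esub> (y \<otimes>\<^bsub>L\<^esub> z) = ((x \<otimes>\<^bsub>L\<^esub> y) \<otimes>\<^bsub>L\<^esub> z) \<oplus>\<^bsub>L\<^esub> (y \<otimes>\<^bsub>L\<^esub> (x \<otimes>\<^bsub>L\<^esub> z))"
    and right_leibniz:
      "\<lbrakk>x \<in> carrier L; y \<in> carrier L; z \<in> carrier L\<rbrakk> \<Longrightarrow>
        (x \<otimes>\<^bsub>L\<^esub> y) \<otimes>\<^bsub>L\<^esub> z = ((x \<otimes>\<^bsub>L\<^esub> z) \<otimes>\<^bsub>L\<^esub> y) \<oplus>\<^bsub>L\<^esub> (x \<otimes>\<^bsub>L\<^esub> (y \<otimes>\<^bsub>L\<^esub> z))"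

definition lin_span ::
    "('f, 'm) ring_scheme \<Rightarrow> ('f, 'v, 'n) module_scheme \<Rightarrow> 'v set \<Rightarrow> 'v set" where
  "lin_span F A S = \<Inter> {H. submodule H F A \<and> S \<subseteq> H}"

definition subspace_prod ::
    "('f, 'm) ring_scheme \<Rightarrow> ('f, 'v, 'n) module_scheme \<Rightarrow> 'v set \<Rightarrow> 'v set \<Rightarrow> 'v set" where
  "subspace_prod F A U V = lin_span F A {x \<otimes>\<^bsub>A\<^esub> y | x y. x \<in> U \<and> y \<in> V}"

primrec derived_series ::
    "('f, 'm) ring_scheme \<Rightarrow> ('f, 'v, 'n) module_scheme \<Rightarrow> nat \<Rightarrow> 'v set" where
  "derived_series F A 0 = carrier A"
| "derived_series F A (Suc n) =
     subspace_prod F A (derived_series F A n) (derived_series F A n)"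

definition solvable_algebra ::
    "('f, 'm) ring_scheme \<Rightarrow> ('f, 'v, 'n) module_scheme \<Rightarrow> bool" where
  "solvable_algebra F A \<longleftrightarrow> (\<exists>r. derived_series F A r = {\<zero>\<^bsub>A\<^esub>})"

text \<open>
  This extends the library construction \<^const>\<open>FactRing\<close> by the induced scalar multiplication.
  It is meaningful when \<open>I\<close> is a two-sided ideal: each union is then a union of equal cosets.
\<close>

definition quotient_algebra ::
    "('f, 'v, 'n) module_scheme \<Rightarrow> 'v set \<Rightarrow> ('f, 'v set) module" where
  "quotient_algebra A I =
    \<lparr>carrier = a_rcosets\<^bsub>A\<^esub> I, mult = rcoset_mult A I, one = I +>\<^bsub>A\<^esub> \<one>\<^bsub>A\<^esub>,
     zero = I, add = set_add A,
     smult = (\<lambda>a U. \<Union>x\<in>U. I +>\<^bsub>A\<^esub> (a \<odot>\<^bsub>A\<^esub> x))\<rparr>"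

definition leibniz_kernel ::
    "('f, 'm) ring_scheme \<Rightarrow> ('f, 'v, 'n) module_scheme \<Rightarrow> 'v set" where
  "leibniz_kernel F L = lin_span F L {x \<otimes>\<^bsub>L\<^esub> x | x. x \<in> carrier L}"

definition alg_center :: "('f, 'v, 'n) module_scheme \<Rightarrow> 'v set" where
  "alg_center L =
    {c \<in> carrier L. \<forall>x\<in>carrier L. c \<otimes>\<^bsub>L\<^esub> x = \<zero>\<^bsub>L\<^esub> \<and> x \<otimes>\<^bsub>L\<^esub> c = \<zero>\<^bsub>L\<^esub>}"

definition linear_operators ::
    "('f, 'm) ring_scheme \<Rightarrow> ('f, 'v, 'n) module_scheme \<Rightarrow> ('v \<Rightarrow> 'v) set" where
  "linear_operators F A =
    {f \<in> carrier A \<rightarrow>\<^sub>E carrier A.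
      (\<forall>x\<in>carrier A. \<forall>y\<in>carrier A. f (x \<oplus>\<^bsub>A\<^esub> y) = f x \<oplus>\<^bsub>A\<^esub> f y) \<and>
      (\<forall>a\<in>carrier F. \<forall>x\<in>carrier A. f (a \<odot>\<^bsub>A\<^esub> x) = a \<odot>\<^bsub>A\<^esub> f x)}"

text \<open>
  Operators are extensional functions, so that equality of operators on the carrier is equality
  of functions. The product of the algebra \<open>gl\<close> is the commutator.
\<close>

definition gl ::
    "('f, 'm) ring_scheme \<Rightarrow> ('f, 'v, 'n) module_scheme \<Rightarrow> ('f, 'v \<Rightarrow> 'v) module" where
  "gl F A =
    \<lparr>carrier = linear_operators F A,
     mult = (\<lambda>f g. \<lambda>x\<in>carrier A. f (g x) \<ominus>\<^bsub>A\<^esub> g (f x)),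
     one = undefined,
     zero = (\<lambda>x\<in>carrier A. \<zero>\<^bsub>A\<^esub>),
     add = (\<lambda>f g. \<lambda>x\<in>carrier A. f x \<oplus>\<^bsub>A\<^esub> g x),
     smult = (\<lambda>a f. \<lambda>x\<in>carrier A. a \<odot>\<^bsub>A\<^esub> f x)\<rparr>"

definition left_mult :: "('f, 'v, 'n) module_scheme \<Rightarrow> 'v \<Rightarrow> 'v \<Rightarrow> 'v" where
  "left_mult A a = (\<lambda>x\<in>carrier A. a \<otimes>\<^bsub>A\<^esub> x)"

definition right_mult :: "('f, 'v, 'n) module_scheme \<Rightarrow> 'v \<Rightarrow> 'v \<Rightarrow> 'v" where
  "right_mult A a = (\<lambda>x\<in>carrier A. x \<otimes>\<^bsub>A\<^esub> a)"

definition left_mults :: "('f, 'v, 'n) module_scheme \<Rightarrow> ('v \<Rightarrow> 'v) set" where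
  "left_mults A = left_mult A ` carrier A"

definition right_mults :: "('f, 'v, 'n) module_scheme \<Rightarrow> ('v \<Rightarrow> 'v) set" where
  "right_mults A = right_mult A ` carrier A"

definition subalgebra_of ::
    "'v set \<Rightarrow> ('f, 'm) ring_scheme \<Rightarrow> ('f, 'v, 'n) module_scheme \<Rightarrow> bool" where
  "subalgebra_of K F A \<longleftrightarrow>
    submodule K F A \<and> (\<forall>x\<in>K. \<forall>y\<in>K. x \<otimes>\<^bsub>A\<^esub> y \<in> K)"

definition generated_subalgebra ::
    "('f, 'm) ring_scheme \<Rightarrow> ('f, 'v, 'n) module_scheme \<Rightarrow> 'v set \<Rightarrow> 'v set" where
  "generated_subalgebra F A S = \<Inter> {K. subalgebra_of K F A \<and> S \<subseteq> K}"

definition lie_multiplications ::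
    "('f, 'm) ring_scheme \<Rightarrow> ('f, 'v, 'n) module_scheme \<Rightarrow> ('v \<Rightarrow> 'v) set" where
  "lie_multiplications F L = generated_subalgebra F (gl F L) (left_mults L \<union> right_mults L)"

text \<open>
  For a Lie subalgebra \<open>S\<close> of \<open>gl\<close>: the product is still the commutator, and spans are taken inside \<open>S\<close>.
\<close>

abbreviation gl_sub ::
    "('f, 'm) ring_scheme \<Rightarrow> ('f, 'v, 'n) module_scheme \<Rightarrow> ('v \<Rightarrow> 'v) set \<Rightarrow>
      ('f, 'v \<Rightarrow> 'v) module" where
  "gl_sub F L S \<equiv> (gl F L)\<lparr>carrier := S\<rparr>"

end

theory Submission
  imports Defs
begin

text \<open>
  Comparing the two Leibniz identities gives \<open>(xz)y = - y(xz)\<close>. Hence the product of \<open>L\<close> turns under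
  each of \<open>a \<mapsto> L\<^sub>a\<close> and \<open>a \<mapsto> -R\<^sub>a\<close> into the commutator, and every commutator of left or right
  multiplications is itself a left multiplication. Moreover every square is central. So the two
  quotients and the algebras \<open>L(L)\<close> and \<open>R(L)\<close> are all images of \<open>L\<close> under epimorphisms whose kernel
  has zero product; such epimorphisms preserve and reflect solvability. Finally
  \<open>L(L) \<subseteq> Lie(L)\<close> and the derived algebra of \<open>Lie(L)\<close> lies in \<open>L(L)\<close>.
\<close>

section \<open>Spans and derived series\<close>

lemma submodule_zero: "submodule H R M \<Longrightarrow> \<zero>\<^bsub>M\<^esub> \<in> H"
  using subgroup.one_closed[of H "add_monoid M"] by (simp add: submodule_def)

text \<open>Closure under negation is scalar multiplication by \<open>\<ominus> \<one>\<close>, so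
  the linear-subspace conditions suffice.\<close>

lemma (in module) submoduleI_smult:
  assumes "H \<subseteq> carrier M" "\<zero>\<^bsub>M\<^esub> \<in> H"
    and "\<And>x y. \<lbrakk>x \<in> H; y \<in> H\<rbrakk> \<Longrightarrow> x \<oplus>\<^bsub>M\<^esub> y \<in> H"
    and "\<And>a x. \<lbrakk>a \<in> carrier R; x \<in> H\<rbrakk> \<Longrightarrow> a \<odot>\<^bsub>M\<^esub> x \<in> H"
  shows "submodule H R M"
proof (rule submoduleI)
  fix x assume x: "x \<in> H"
  then have "(\<ominus> \<one>) \<odot>\<^bsub>M\<^esub> x = \<ominus>\<^bsub>M\<^esub> x"
    using assms(1) smult_l_minus[of \<one> x] by auto
  then show "\<ominus>\<^bsub>M\<^esub> x \<in> H"
    using assms(4)[of "\<ominus> \<one>" x] x by simp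
qed (use assms in auto)

lemma lin_span_superset: "S \<subseteq> lin_span R M S"
  by (auto simp: lin_span_def)

lemma lin_span_least: "submodule H R M \<Longrightarrow> S \<subseteq> H \<Longrightarrow> lin_span R M S \<subseteq> H"
  by (auto simp: lin_span_def)

text \<open>An intersection of submodules is a submodule as soon as it lies in the carrier; as
  \<open>S\<close> lies there, the carrier itself is one of the intersected submodules.\<close>

lemma (in module) lin_span_submodule:
  assumes "S \<subseteq> carrier M"
  shows "submodule (lin_span R M S) R M"
proof (rule submoduleI_smult)
  show "lin_span R M S \<subseteq> carrier M"
    by (rule lin_span_least[OF carrier_is_submodule assms])
qed (auto simp: lin_span_def submodule_zero submoduleE(4,5))

lemma (in module) submodule_carrier_update_iff:
  assumes K: "submodule K R M"
  shows "submodule H R (M\<lparr>carrier := K\<rparr>) \<longleftrightarrow> submodule H R M \<and> H \<subseteq> K"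
proof
  interpret K: module R "M\<lparr>carrier := K\<rparr>"
    by (rule submodule.submodule_is_module[OF K module_axioms])
  note KM = submoduleE(1)[OF K]
  show "submodule H R M \<and> H \<subseteq> K" if H: "submodule H R (M\<lparr>carrier := K\<rparr>)"
  proof
    show "H \<subseteq> K" using K.submoduleE(1)[OF H] by simp
    then show "submodule H R M"
      using KM K.submoduleE(4,5)[OF H] submodule_zero[OF H] by (intro submoduleI_smult) auto
  qed
  show "submodule H R (M\<lparr>carrier := K\<rparr>)" if H: "submodule H R M \<and> H \<subseteq> K"
    using H submoduleE(4,5)[of H] submodule_zero[of H] by (intro K.submoduleI_smult) auto
qed

text \<open>The derived series of a subalgebra takes its spans inside that subalgebra. Since the
  span of \<open>S\<close> in \<open>M\<close> already lies in \<open>K\<close>, all of them can be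
  computed in the ambient module.\<close>

lemma (in module) lin_span_carrier_update:
  assumes K: "submodule K R M" and S: "S \<subseteq> K"
  shows "lin_span R (M\<lparr>carrier := K\<rparr>) S = lin_span R M S"
proof
  have "S \<subseteq> carrier M" using S submoduleE(1)[OF K] by blast
  then show "lin_span R (M\<lparr>carrier := K\<rparr>) S \<subseteq> lin_span R M S"
    using lin_span_submodule[of S] lin_span_least[OF K S] lin_span_superset[of S R M]
    by (simp add: lin_span_least submodule_carrier_update_iff[OF K])
  show "lin_span R M S \<subseteq> lin_span R (M\<lparr>carrier := K\<rparr>) S"
    by (auto simp: lin_span_def submodule_carrier_update_iff[OF K])
qed

lemma (in module) derived_series_submodule:
  assumes "\<And>x y. \<lbrakk>x \<in> carrier M; y \<in> carrier M\<rbrakk> \<Longrightarrow> x \<otimes>\<^bsub>M\<^esub> y \<in> carrier M"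
  shows "submodule (derived_series R M n) R M"
proof (induction n)
  case 0
  show ?case by (simp add: carrier_is_submodule)
next
  case (Suc n)
  show ?case
    using submoduleE(1)[OF Suc] assms
    by (auto simp: subspace_prod_def intro!: lin_span_submodule)
qed

text \<open>Every term of the series contains zero. The inclusion form is the one that chains well
  along inclusions between series.\<close>

lemma (in module) solvable_algebra_iff:
  assumes "\<And>x y. \<lbrakk>x \<in> carrier M; y \<in> carrier M\<rbrakk> \<Longrightarrow> x \<otimes>\<^bsub>M\<^esub> y \<in> carrier M"
  shows "solvable_algebra R M \<longleftrightarrow> (\<exists>r. derived_series R M r \<subseteq> {\<zero>\<^bsub>M\<^esub>})"
  using submodule_zero[OF derived_series_submodule[OF assms]]
  by (auto simp: solvable_algebra_def subset_singleton_iff)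

text \<open>Both series iterate one and the same monotone operation of \<open>M\<close>, sending
  \<open>D\<close> to the span of the products of its elements. An inclusion at positions
  \<open>k\<close> and \<open>l\<close> therefore persists under equal shifts.\<close>

lemma (in module) derived_series_carrier_update_mono:
  assumes U: "subalgebra_of U R M" and V: "subalgebra_of V R M"
    and sub: "derived_series R (M\<lparr>carrier := U\<rparr>) k \<subseteq> derived_series R (M\<lparr>carrier := V\<rparr>) l"
  shows "derived_series R (M\<lparr>carrier := U\<rparr>) (k + n) \<subseteq> derived_series R (M\<lparr>carrier := V\<rparr>) (l + n)"
proof (induction n)
  case 0
  show ?case using sub by simp
next
  case (Suc n)
  \<comment> \<open>Each term of the series of \<open>W\<close> stays in \<open>W\<close>, and
    \<open>W\<close> is closed under products, so the span may be taken in \<open>M\<close>.\<close>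
  have span: "lin_span R (M\<lparr>carrier := W\<rparr>) {x \<otimes>\<^bsub>M\<^esub> y | x y. x \<in> D \<and> y \<in> D} =
      lin_span R M {x \<otimes>\<^bsub>M\<^esub> y | x y. x \<in> D \<and> y \<in> D}"
    if W: "subalgebra_of W R M" and D: "D = derived_series R (M\<lparr>carrier := W\<rparr>) m" for W D m
  proof -
    interpret W: module R "M\<lparr>carrier := W\<rparr>"
      using W submodule.submodule_is_module[OF _ module_axioms] by (auto simp: subalgebra_of_def)
    have "D \<subseteq> W"
      using W.submoduleE(1)[OF W.derived_series_submodule[of m]] W D
      by (auto simp: subalgebra_of_def)
    then show ?thesis
      using W by (intro lin_span_carrier_update) (auto simp: subalgebra_of_def subset_iff)
  qed
  have mono: "lin_span R M S \<subseteq> lin_span R M T" if "S \<subseteq> T" for S T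
    using that by (auto simp: lin_span_def)
  show ?case
    unfolding add_Suc_right derived_series.simps subspace_prod_def
    by (simp add: span[OF U refl] span[OF V refl]) (rule mono, use Suc in blast)
qed


section \<open>Epimorphisms\<close>

text \<open>The target is a bare record whose module laws are derived from surjectivity, so that
  quotients and operator algebras inherit theirs from the source. Preservation of zero is a separate
  axiom because additivity yields it only once the target is known to be a group.\<close>

locale algebra_epi = nonassoc_algebra F A
  for F (structure) and A (structure) +
  fixes B (structure) and h
  assumes image: "h ` carrier A = carrier B"
    and hom_zero: "h \<zero>\<^bsub>A\<^esub> = \<zero>\<^bsub>B\<^esub>"
    and hom_add: "\<lbrakk>x \<in> carrier A; y \<in> carrier A\<rbrakk> \<Longrightarrow> h (x \<oplus>\<^bsub>A\<^esub> y) = h x \<oplus>\<^bsub>B\<^esub> h y"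
    and hom_mult: "\<lbrakk>x \<in> carrier A; y \<in> carrier A\<rbrakk> \<Longrightarrow> h (x \<otimes>\<^bsub>A\<^esub> y) = h x \<otimes>\<^bsub>B\<^esub> h y"
    and hom_smult: "\<lbrakk>a \<in> carrier F; x \<in> carrier A\<rbrakk> \<Longrightarrow> h (a \<odot>\<^bsub>A\<^esub> x) = a \<odot>\<^bsub>B\<^esub> h x"
begin

text \<open>Every element of \<open>B\<close> is some \<open>h x\<close>, and \<open>h\<close>
  carries each module law of \<open>A\<close> to the corresponding law of \<open>B\<close>.\<close>

lemma module_image: "module F B"
proof (rule moduleI)
  show "cring F" by (rule F.is_cring)
  \<comment> \<open>Quantifiers over \<open>B\<close> become quantifiers over \<open>A\<close>; this
    is why each law below is first stated with bounded quantifiers.\<close>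
  have in_B: "(\<forall>u\<in>carrier B. P u) \<longleftrightarrow> (\<forall>x\<in>carrier A. P (h x))" for P
    by (simp flip: image)
  have B: "h x \<in> carrier B" if "x \<in> carrier A" for x using that by (auto simp flip: image)
  show "abelian_group B"
  proof (rule abelian_groupI)
    show "\<zero>\<^bsub>B\<^esub> \<in> carrier B" by (auto simp flip: hom_zero intro: B)
    have "\<forall>u\<in>carrier B. \<forall>v\<in>carrier B. u \<oplus>\<^bsub>B\<^esub> v \<in> carrier B"
      unfolding in_B by (auto simp flip: hom_add intro: B)
    then show "u \<oplus>\<^bsub>B\<^esub> v \<in> carrier B" if "u \<in> carrier B" "v \<in> carrier B" for u v
      using that by blast
    have "\<forall>u\<in>carrier B. \<forall>v\<in>carrier B. \<forall>w\<in>carrier B. u \<oplus>\<^bsub>B\<^esub> v \<oplus>\<^bsub>B\<^esub> w = u \<oplus>\<^bsub>B\<^esub> (v \<oplus>\<^bsub>B\<^esub> w)"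
      unfolding in_B by (auto simp: M.a_assoc simp flip: hom_add)
    then show "u \<oplus>\<^bsub>B\<^esub> v \<oplus>\<^bsub>B\<^esub> w = u \<oplus>\<^bsub>B\<^esub> (v \<oplus>\<^bsub>B\<^esub> w)"
      if "u \<in> carrier B" "v \<in> carrier B" "w \<in> carrier B" for u v w
      using that by blast
    have "\<forall>u\<in>carrier B. \<forall>v\<in>carrier B. u \<oplus>\<^bsub>B\<^esub> v = v \<oplus>\<^bsub>B\<^esub> u"
      unfolding in_B by (auto simp: M.a_comm simp flip: hom_add)
    then show "u \<oplus>\<^bsub>B\<^esub> v = v \<oplus>\<^bsub>B\<^esub> u" if "u \<in> carrier B" "v \<in> carrier B" for u v
      using that by blast
    have "\<forall>u\<in>carrier B. \<zero>\<^bsub>B\<^esub> \<oplus>\<^bsub>B\<^esub> u = u"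
      unfolding in_B by (auto simp flip: hom_add hom_zero)
    then show "\<zero>\<^bsub>B\<^esub> \<oplus>\<^bsub>B\<^esub> u = u" if "u \<in> carrier B" for u
      using that by blast
    have "\<forall>u\<in>carrier B. \<exists>v\<in>carrier B. v \<oplus>\<^bsub>B\<^esub> u = \<zero>\<^bsub>B\<^esub>"
      unfolding in_B
    proof
      fix x assume "x \<in> carrier A"
      then have "h (\<ominus>\<^bsub>A\<^esub> x) \<oplus>\<^bsub>B\<^esub> h x = \<zero>\<^bsub>B\<^esub>" "h (\<ominus>\<^bsub>A\<^esub> x) \<in> carrier B"
        by (auto simp: M.l_neg hom_zero B simp flip: hom_add)
      then show "\<exists>v\<in>carrier B. v \<oplus>\<^bsub>B\<^esub> h x = \<zero>\<^bsub>B\<^esub>" by blast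
    qed
    then show "\<exists>v\<in>carrier B. v \<oplus>\<^bsub>B\<^esub> u = \<zero>\<^bsub>B\<^esub>" if "u \<in> carrier B" for u
      using that by blast
  qed
  have "\<forall>u\<in>carrier B. a \<odot>\<^bsub>B\<^esub> u \<in> carrier B" if "a \<in> carrier F" for a
    unfolding in_B using that by (auto simp flip: hom_smult intro: B)
  then show "a \<odot>\<^bsub>B\<^esub> u \<in> carrier B" if "a \<in> carrier F" "u \<in> carrier B" for a u
    using that by blast
  have "\<forall>u\<in>carrier B. (a \<oplus>\<^bsub>F\<^esub> b) \<odot>\<^bsub>B\<^esub> u = a \<odot>\<^bsub>B\<^esub> u \<oplus>\<^bsub>B\<^esub> b \<odot>\<^bsub>B\<^esub> u"
    if "a \<in> carrier F" "b \<in> carrier F" for a b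
    unfolding in_B using that by (simp add: smult_l_distr flip: hom_smult hom_add)
  then show "(a \<oplus>\<^bsub>F\<^esub> b) \<odot>\<^bsub>B\<^esub> u = a \<odot>\<^bsub>B\<^esub> u \<oplus>\<^bsub>B\<^esub> b \<odot>\<^bsub>B\<^esub> u"
    if "a \<in> carrier F" "b \<in> carrier F" "u \<in> carrier B" for a b u
    using that by blast
  have "\<forall>u\<in>carrier B. \<forall>v\<in>carrier B. a \<odot>\<^bsub>B\<^esub> (u \<oplus>\<^bsub>B\<^esub> v) = a \<odot>\<^bsub>B\<^esub> u \<oplus>\<^bsub>B\<^esub> a \<odot>\<^bsub>B\<^esub> v"
    if "a \<in> carrier F" for a
    unfolding in_B using that by (simp add: smult_r_distr flip: hom_smult hom_add)
  then show "a \<odot>\<^bsub>B\<^esub> (u \<oplus>\<^bsub>B\<^esub> v) = a \<odot>\<^bsub>B\<^esub> u \<oplus>\<^bsub>B\<^esub> a \<odot>\<^bsub>B\<^esub> v"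
    if "a \<in> carrier F" "u \<in> carrier B" "v \<in> carrier B" for a u v
    using that by blast
  have "\<forall>u\<in>carrier B. (a \<otimes>\<^bsub>F\<^esub> b) \<odot>\<^bsub>B\<^esub> u = a \<odot>\<^bsub>B\<^esub> (b \<odot>\<^bsub>B\<^esub> u)"
    if "a \<in> carrier F" "b \<in> carrier F" for a b
    unfolding in_B using that by (simp add: smult_assoc1 flip: hom_smult)
  then show "(a \<otimes>\<^bsub>F\<^esub> b) \<odot>\<^bsub>B\<^esub> u = a \<odot>\<^bsub>B\<^esub> (b \<odot>\<^bsub>B\<^esub> u)"
    if "a \<in> carrier F" "b \<in> carrier F" "u \<in> carrier B" for a b u
    using that by blast
  have "\<forall>u\<in>carrier B. \<one>\<^bsub>F\<^esub> \<odot>\<^bsub>B\<^esub> u = u"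
    unfolding in_B by (simp flip: hom_smult)
  then show "\<one>\<^bsub>F\<^esub> \<odot>\<^bsub>B\<^esub> u = u" if "u \<in> carrier B" for u
    using that by blast
qed

sublocale B: module F B
  by (rule module_image)

lemma image_closed: "x \<in> carrier A \<Longrightarrow> h x \<in> carrier B"
  by (auto simp flip: image)

lemma image_prod_closed: "\<lbrakk>u \<in> carrier B; v \<in> carrier B\<rbrakk> \<Longrightarrow> u \<otimes>\<^bsub>B\<^esub> v \<in> carrier B"
  by (auto simp flip: image hom_mult intro!: imageI prod_closed)

text \<open>The preimage of a submodule and the image of a submodule are again submodules; with
  minimality of spans, each fact gives one inclusion.\<close>

lemma image_lin_span:
  assumes S: "S \<subseteq> carrier A"
  shows "h ` lin_span F A S = lin_span F B (h ` S)"
proof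
  let ?P = "{x \<in> carrier A. h x \<in> lin_span F B (h ` S)}"
  have "submodule (lin_span F B (h ` S)) F B"
    using S image_closed by (intro B.lin_span_submodule) auto
  note span_B = submodule_zero[OF this] B.submoduleE(4,5)[OF this]
  have "submodule ?P F A"
    by (rule submoduleI_smult) (auto simp: hom_zero hom_add hom_smult span_B)
  moreover have "S \<subseteq> ?P" using S lin_span_superset[of "h ` S" F B] by auto
  ultimately have "lin_span F A S \<subseteq> ?P" by (rule lin_span_least)
  then show "h ` lin_span F A S \<subseteq> lin_span F B (h ` S)" by blast
next
  note sub = lin_span_submodule[OF S]
  note span_A = submodule_zero[OF sub] submoduleE(4,5)[OF sub]
  have cl: "x \<in> carrier A" if "x \<in> lin_span F A S" for x using submoduleE(1)[OF sub] that by blast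
  have "submodule (h ` lin_span F A S) F B"
  proof (rule B.submoduleI_smult)
    show "h ` lin_span F A S \<subseteq> carrier B" by (auto intro: image_closed cl)
    show "\<zero>\<^bsub>B\<^esub> \<in> h ` lin_span F A S" by (auto simp flip: hom_zero intro: span_A)
  qed (auto simp: cl simp flip: hom_add hom_smult intro!: imageI span_A)
  then show "lin_span F B (h ` S) \<subseteq> h ` lin_span F A S"
    by (rule lin_span_least) (simp add: image_mono lin_span_superset)
qed

lemma image_derived_series: "h ` derived_series F A n = derived_series F B n"
proof (induction n)
  case 0
  show ?case by (simp add: image)
next
  case (Suc n)
  let ?D = "derived_series F A n"
  have D: "?D \<subseteq> carrier A"
    by (rule submoduleE(1)[OF derived_series_submodule]) (rule prod_closed)
  have "h ` {x \<otimes>\<^bsub>A\<^esub> y | x y. x \<in> ?D \<and> y \<in> ?D} =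
      {u \<otimes>\<^bsub>B\<^esub> v | u v. u \<in> h ` ?D \<and> v \<in> h ` ?D}" (is "h ` ?S = ?T")
  proof
    show "h ` ?S \<subseteq> ?T"
    proof
      fix w assume "w \<in> h ` ?S"
      then obtain x y where "x \<in> ?D" "y \<in> ?D" "w = h (x \<otimes>\<^bsub>A\<^esub> y)" by blast
      moreover from this have "w = h x \<otimes>\<^bsub>B\<^esub> h y" using D hom_mult by (metis subsetD)
      ultimately show "w \<in> ?T" by blast
    qed
    show "?T \<subseteq> h ` ?S"
    proof
      fix w assume "w \<in> ?T"
      then obtain x y where "x \<in> ?D" "y \<in> ?D" "w = h x \<otimes>\<^bsub>B\<^esub> h y" by blast
      moreover from this have "w = h (x \<otimes>\<^bsub>A\<^esub> y)" using D hom_mult by (metis subsetD)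
      ultimately show "w \<in> h ` ?S" by blast
    qed
  qed
  moreover have "h ` lin_span F A ?S = lin_span F B (h ` ?S)"
    using D prod_closed by (intro image_lin_span) blast
  ultimately show ?case
    by (simp add: subspace_prod_def Suc.IH)
qed

text \<open>If the \<open>r\<close>-th derived term of \<open>B\<close> vanishes, that of
  \<open>A\<close> lies in the kernel of \<open>h\<close>. Products inside the kernel are zero, so
  the series of \<open>A\<close> ends at most one step later.\<close>

lemma solvable_iff:
  assumes ker: "\<And>x y. \<lbrakk>x \<in> carrier A; y \<in> carrier A; h x = \<zero>\<^bsub>B\<^esub>; h y = \<zero>\<^bsub>B\<^esub>\<rbrakk> \<Longrightarrow>
    x \<otimes>\<^bsub>A\<^esub> y = \<zero>\<^bsub>A\<^esub>"
  shows "solvable_algebra F A \<longleftrightarrow> solvable_algebra F B"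
proof
  show "solvable_algebra F B" if "solvable_algebra F A"
    using that unfolding solvable_algebra_def image_derived_series[symmetric]
    by (metis hom_zero image_empty image_insert)
next
  assume "solvable_algebra F B"
  then obtain r where r: "h ` derived_series F A r = {\<zero>\<^bsub>B\<^esub>}"
    by (auto simp: solvable_algebra_def image_derived_series)
  let ?D = "derived_series F A r"
  have "?D \<subseteq> carrier A"
    by (rule submoduleE(1)[OF derived_series_submodule]) (rule prod_closed)
  with r have "{x \<otimes>\<^bsub>A\<^esub> y | x y. x \<in> ?D \<and> y \<in> ?D} \<subseteq> {\<zero>\<^bsub>A\<^esub>}"
    by (auto intro!: ker)
  moreover have "submodule {\<zero>\<^bsub>A\<^esub>} F A"
    by (rule submoduleI_smult) auto
  ultimately have "derived_series F A (Suc r) \<subseteq> {\<zero>\<^bsub>A\<^esub>}"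
    unfolding derived_series.simps subspace_prod_def by (intro lin_span_least)
  then show "solvable_algebra F A"
    using solvable_algebra_iff prod_closed by blast
qed

end


section \<open>The Lie algebra of linear operators\<close>

lemma gl_simps [simp]:
  "carrier (gl F A) = linear_operators F A"
  "f \<otimes>\<^bsub>gl F A\<^esub> g = (\<lambda>x\<in>carrier A. f (g x) \<ominus>\<^bsub>A\<^esub> g (f x))"
  "\<zero>\<^bsub>gl F A\<^esub> = (\<lambda>x\<in>carrier A. \<zero>\<^bsub>A\<^esub>)"
  "f \<oplus>\<^bsub>gl F A\<^esub> g = (\<lambda>x\<in>carrier A. f x \<oplus>\<^bsub>A\<^esub> g x)"
  "a \<odot>\<^bsub>gl F A\<^esub> f = (\<lambda>x\<in>carrier A. a \<odot>\<^bsub>A\<^esub> f x)"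
  by (simp_all add: gl_def)

lemma linear_operatorsD:
  assumes "f \<in> linear_operators F A"
  shows "f \<in> extensional (carrier A)"
    "x \<in> carrier A \<Longrightarrow> f x \<in> carrier A"
    "\<lbrakk>x \<in> carrier A; y \<in> carrier A\<rbrakk> \<Longrightarrow> f (x \<oplus>\<^bsub>A\<^esub> y) = f x \<oplus>\<^bsub>A\<^esub> f y"
    "\<lbrakk>a \<in> carrier F; x \<in> carrier A\<rbrakk> \<Longrightarrow> f (a \<odot>\<^bsub>A\<^esub> x) = a \<odot>\<^bsub>A\<^esub> f x"
  using assms by (auto simp: linear_operators_def PiE_def)

lemma linear_operatorsI:
  assumes "\<And>x. x \<in> carrier A \<Longrightarrow> f x \<in> carrier A"
    "\<And>x y. \<lbrakk>x \<in> carrier A; y \<in> carrier A\<rbrakk> \<Longrightarrow> f (x \<oplus>\<^bsub>A\<^esub> y) = f x \<oplus>\<^bsub>A\<^esub> f y"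
    "\<And>a x. \<lbrakk>a \<in> carrier F; x \<in> carrier A\<rbrakk> \<Longrightarrow> f (a \<odot>\<^bsub>A\<^esub> x) = a \<odot>\<^bsub>A\<^esub> f x"
    "f \<in> extensional (carrier A)"
  shows "f \<in> linear_operators F A"
  using assms by (auto simp: linear_operators_def PiE_def)

context module
begin

lemma gl_add_closed:
  assumes "f \<in> linear_operators R M" "g \<in> linear_operators R M"
  shows "(\<lambda>x\<in>carrier M. f x \<oplus>\<^bsub>M\<^esub> g x) \<in> linear_operators R M"
  using assms
  by (intro linear_operatorsI) (auto simp: linear_operatorsD smult_r_distr M.a_ac)

lemma gl_smult_closed:
  assumes "a \<in> carrier R" "f \<in> linear_operators R M"
  shows "(\<lambda>x\<in>carrier M. a \<odot>\<^bsub>M\<^esub> f x) \<in> linear_operators R M"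
  using assms
  by (intro linear_operatorsI)
    (auto simp: linear_operatorsD smult_r_distr R.m_comm simp flip: smult_assoc1)

lemma gl_zero_closed: "(\<lambda>x\<in>carrier M. \<zero>\<^bsub>M\<^esub>) \<in> linear_operators R M"
  by (intro linear_operatorsI) auto

lemma gl_mult_closed:
  assumes "f \<in> linear_operators R M" "g \<in> linear_operators R M"
  shows "(\<lambda>x\<in>carrier M. f (g x) \<ominus>\<^bsub>M\<^esub> g (f x)) \<in> linear_operators R M"
  using assms
  by (intro linear_operatorsI)
    (auto simp: linear_operatorsD smult_r_distr smult_r_minus M.minus_add M.minus_eq M.a_ac)

lemma gl_module: "module R (gl R M)"
proof (rule moduleI)
  show "cring R" by (rule R.is_cring)
  show "abelian_group (gl R M)"
  proof (rule abelian_groupI)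
    fix f assume f: "f \<in> carrier (gl R M)"
    \<comment> \<open>The negative of \<open>f\<close> is written as a scalar multiple, so that its
      linearity is an instance of \<open>gl_smult_closed\<close>.\<close>
    let ?g = "\<lambda>x\<in>carrier M. (\<ominus> \<one>) \<odot>\<^bsub>M\<^esub> f x"
    have "?g \<in> carrier (gl R M)" using f gl_smult_closed by simp
    moreover have "?g \<oplus>\<^bsub>gl R M\<^esub> f = \<zero>\<^bsub>gl R M\<^esub>"
      using f by (auto simp: linear_operatorsD smult_l_minus M.l_neg cong: restrict_cong)
    ultimately show "\<exists>g\<in>carrier (gl R M). g \<oplus>\<^bsub>gl R M\<^esub> f = \<zero>\<^bsub>gl R M\<^esub>" by blast
    \<comment> \<open>The left side is restricted to the carrier; it equals \<open>f\<close> as a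
      function because operators are extensional.\<close>
    show "\<zero>\<^bsub>gl R M\<^esub> \<oplus>\<^bsub>gl R M\<^esub> f = f"
      using f by (intro extensionalityI[where A = "carrier M"]) (auto simp: linear_operatorsD)
  qed (auto simp: gl_add_closed gl_zero_closed linear_operatorsD M.a_ac cong: restrict_cong)
  fix f assume f: "f \<in> carrier (gl R M)"
  show "\<one> \<odot>\<^bsub>gl R M\<^esub> f = f"
    using f by (intro extensionalityI[where A = "carrier M"]) (auto simp: linear_operatorsD)
qed (auto simp: gl_smult_closed linear_operatorsD smult_l_distr smult_r_distr smult_assoc1
    cong: restrict_cong)

lemma gl_subalgebraD:
  assumes "subalgebra_of K R (gl R M)"
  shows "module R (gl_sub R M K)"
    "\<And>f g. \<lbrakk>f \<in> K; g \<in> K\<rbrakk> \<Longrightarrow> f \<otimes>\<^bsub>gl R M\<^esub> g \<in> K"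
  using assms submodule.submodule_is_module[OF _ gl_module] by (auto simp: subalgebra_of_def)

lemma gl_sub_solvable_iff:
  assumes "subalgebra_of K R (gl R M)"
  shows "solvable_algebra R (gl_sub R M K) \<longleftrightarrow>
    (\<exists>r. derived_series R (gl_sub R M K) r \<subseteq> {\<zero>\<^bsub>gl R M\<^esub>})"
  using module.solvable_algebra_iff[OF gl_subalgebraD(1)[OF assms]] gl_subalgebraD(2)[OF assms]
  by simp

lemma generated_subalgebra_subalgebra:
  assumes S: "S \<subseteq> linear_operators R M"
  shows "subalgebra_of (generated_subalgebra R (gl R M) S) R (gl R M)"
proof -
  interpret gl: module R "gl R M" by (rule gl_module)
  \<comment> \<open>The whole of \<open>gl\<close> is one of the intersected subalgebras, which
    bounds the intersection.\<close>
  have "subalgebra_of (linear_operators R M) R (gl R M)"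
    using gl.carrier_is_submodule by (auto simp: subalgebra_of_def gl_mult_closed)
  then have "generated_subalgebra R (gl R M) S \<subseteq> linear_operators R M"
    using S by (auto simp: generated_subalgebra_def)
  moreover have "submodule (generated_subalgebra R (gl R M) S) R (gl R M)"
    if "generated_subalgebra R (gl R M) S \<subseteq> linear_operators R M"
    using that
    by (intro gl.submoduleI_smult)
      (auto simp: generated_subalgebra_def subalgebra_of_def simp del: gl_simps(2-)
        intro: submodule_zero gl.submoduleE(4,5))
  ultimately show ?thesis
    by (auto simp: subalgebra_of_def generated_subalgebra_def simp del: gl_simps(2-))
qed

end


section \<open>Symmetric Leibniz algebras\<close>

context nonassoc_algebra
begin

lemma zero_prod [simp]: "x \<in> carrier A \<Longrightarrow> \<zero>\<^bsub>A\<^esub> \<otimes>\<^bsub>A\<^esub> x = \<zero>\<^bsub>A\<^esub>"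
  using prod_smult_left[of "\<zero>" "\<zero>\<^bsub>A\<^esub>" x] prod_closed[of "\<zero>\<^bsub>A\<^esub>" x] by simp

lemma prod_zero [simp]: "x \<in> carrier A \<Longrightarrow> x \<otimes>\<^bsub>A\<^esub> \<zero>\<^bsub>A\<^esub> = \<zero>\<^bsub>A\<^esub>"
  using prod_smult_right[of "\<zero>" x "\<zero>\<^bsub>A\<^esub>"] prod_closed[of x "\<zero>\<^bsub>A\<^esub>"] by simp

lemma minus_prod:
  assumes "x \<in> carrier A" "y \<in> carrier A"
  shows "(\<ominus>\<^bsub>A\<^esub> x) \<otimes>\<^bsub>A\<^esub> y = \<ominus>\<^bsub>A\<^esub> (x \<otimes>\<^bsub>A\<^esub> y)"
  using assms prod_smult_left[of "\<ominus> \<one>" x y] by (simp add: smult_l_minus prod_closed)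

lemma prod_minus:
  assumes "x \<in> carrier A" "y \<in> carrier A"
  shows "x \<otimes>\<^bsub>A\<^esub> (\<ominus>\<^bsub>A\<^esub> y) = \<ominus>\<^bsub>A\<^esub> (x \<otimes>\<^bsub>A\<^esub> y)"
  using assms prod_smult_right[of "\<ominus> \<one>" x y] by (simp add: smult_l_minus prod_closed)

lemma alg_center_submodule: "submodule (alg_center A) F A"
  by (rule submoduleI_smult)
    (auto simp: alg_center_def prod_add_left prod_add_right prod_smult_left prod_smult_right)

lemma left_mult_linear: "a \<in> carrier A \<Longrightarrow> left_mult A a \<in> linear_operators F A"
  by (rule linear_operatorsI)
    (auto simp: left_mult_def prod_closed prod_add_right prod_smult_right)

lemma right_mult_linear: "a \<in> carrier A \<Longrightarrow> right_mult A a \<in> linear_operators F A"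
  by (rule linear_operatorsI)
    (auto simp: right_mult_def prod_closed prod_add_left prod_smult_left)

text \<open>A central subspace is automatically an ideal. The point is that the unions defining
  product and scalar action on cosets are unions of equal cosets.\<close>

lemma quotient_epi:
  assumes I: "submodule I F A" and central: "I \<subseteq> alg_center A"
  shows "algebra_epi F A (quotient_algebra A I) (\<lambda>x. I +>\<^bsub>A\<^esub> x)"
proof
  have sub: "additive_subgroup I A"
    using I by (simp add: additive_subgroup_def submodule_def)
  interpret I: abelian_subgroup I A
    by (rule abelian_subgroupI3[OF sub M.abelian_group_axioms])
  have carr: "i \<in> carrier A" if "i \<in> I" for i using submoduleE(1)[OF I] that by blast
  have absorb: "I +>\<^bsub>A\<^esub> (i \<oplus>\<^bsub>A\<^esub> x) = I +>\<^bsub>A\<^esub> x" if "i \<in> I" "x \<in> carrier A" for i x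
    using that carr M.a_coset_add_assoc[of I i x] M.a_coset_join2[OF _ I.a_subgroup]
    by (metis I.a_subset)
  have coset: "I +>\<^bsub>A\<^esub> x = {i \<oplus>\<^bsub>A\<^esub> x | i. i \<in> I}" for x
    by (auto simp: a_r_coset_def')
  show "(\<lambda>x. I +>\<^bsub>A\<^esub> x) ` carrier A = carrier (quotient_algebra A I)"
    by (auto simp: quotient_algebra_def A_RCOSETS_def')
  show "I +>\<^bsub>A\<^esub> \<zero>\<^bsub>A\<^esub> = \<zero>\<^bsub>quotient_algebra A I\<^esub>"
    by (simp add: quotient_algebra_def I.a_subset)
  fix x assume x: "x \<in> carrier A"
  show "I +>\<^bsub>A\<^esub> (a \<odot>\<^bsub>A\<^esub> x) = a \<odot>\<^bsub>quotient_algebra A I\<^esub> (I +>\<^bsub>A\<^esub> x)" if a: "a \<in> carrier F" for a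
  proof -
    have "I +>\<^bsub>A\<^esub> (a \<odot>\<^bsub>A\<^esub> (i \<oplus>\<^bsub>A\<^esub> x)) = I +>\<^bsub>A\<^esub> (a \<odot>\<^bsub>A\<^esub> x)" if "i \<in> I" for i
      using that a x submoduleE(4)[OF I] by (simp add: carr smult_r_distr absorb)
    then have "I +>\<^bsub>A\<^esub> (a \<odot>\<^bsub>A\<^esub> u) = I +>\<^bsub>A\<^esub> (a \<odot>\<^bsub>A\<^esub> x)" if "u \<in> I +>\<^bsub>A\<^esub> x" for u
      using that by (auto simp: coset[of x])
    \<comment> \<open>The coset is nonempty, so the union of the constant family is its common value
      and not the empty set.\<close>
    moreover have "x \<in> I +>\<^bsub>A\<^esub> x" by (rule I.a_rcos_self[OF x])
    ultimately have "(\<Union>u\<in>I +>\<^bsub>A\<^esub> x. I +>\<^bsub>A\<^esub> (a \<odot>\<^bsub>A\<^esub> u)) = I +>\<^bsub>A\<^esub> (a \<odot>\<^bsub>A\<^esub> x)"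
      by (intro UN_constant_eq ballI)
    then show ?thesis
      by (simp add: quotient_algebra_def)
  qed
  fix y assume y: "y \<in> carrier A"
  show "I +>\<^bsub>A\<^esub> (x \<oplus>\<^bsub>A\<^esub> y) = (I +>\<^bsub>A\<^esub> x) \<oplus>\<^bsub>quotient_algebra A I\<^esub> (I +>\<^bsub>A\<^esub> y)"
    using x y by (simp add: quotient_algebra_def I.a_rcos_sum)
  \<comment> \<open>Centrality makes the products of representatives equal in \<open>A\<close>
    itself, not merely modulo \<open>I\<close>.\<close>
  have "(i \<oplus>\<^bsub>A\<^esub> x) \<otimes>\<^bsub>A\<^esub> (j \<oplus>\<^bsub>A\<^esub> y) = x \<otimes>\<^bsub>A\<^esub> y" if ij: "i \<in> I" "j \<in> I" for i j
  proof -
    have "i \<otimes>\<^bsub>A\<^esub> z = \<zero>\<^bsub>A\<^esub>" "z \<otimes>\<^bsub>A\<^esub> j = \<zero>\<^bsub>A\<^esub>" if "z \<in> carrier A" for z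
      using ij central that by (auto simp: alg_center_def)
    then show ?thesis
      using ij x y by (simp add: carr prod_add_left prod_add_right prod_closed)
  qed
  then have "u \<otimes>\<^bsub>A\<^esub> v = x \<otimes>\<^bsub>A\<^esub> y" if "u \<in> I +>\<^bsub>A\<^esub> x" "v \<in> I +>\<^bsub>A\<^esub> y" for u v
    using that by (auto simp: coset[of x] coset[of y])
  moreover have "x \<in> I +>\<^bsub>A\<^esub> x" "y \<in> I +>\<^bsub>A\<^esub> y" using I.a_rcos_self x y by auto
  ultimately have "(\<Union>u\<in>I +>\<^bsub>A\<^esub> x. \<Union>v\<in>I +>\<^bsub>A\<^esub> y. I +>\<^bsub>A\<^esub> (u \<otimes>\<^bsub>A\<^esub> v)) = I +>\<^bsub>A\<^esub> (x \<otimes>\<^bsub>A\<^esub> y)"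
    by (intro UN_constant_eq ballI arg_cong[where f = "\<lambda>z. I +>\<^bsub>A\<^esub> z"])
  then show "I +>\<^bsub>A\<^esub> (x \<otimes>\<^bsub>A\<^esub> y) = (I +>\<^bsub>A\<^esub> x) \<otimes>\<^bsub>quotient_algebra A I\<^esub> (I +>\<^bsub>A\<^esub> y)"
    by (simp add: quotient_algebra_def rcoset_mult_def)
qed

text \<open>The kernel of the projection is \<open>I\<close>, and a central element annihilates
  everything.\<close>

lemma quotient_solvable_iff:
  assumes I: "submodule I F A" and central: "I \<subseteq> alg_center A"
  shows "solvable_algebra F A \<longleftrightarrow> solvable_algebra F (quotient_algebra A I)"
proof -
  interpret Q: algebra_epi F A "quotient_algebra A I" "\<lambda>x. I +>\<^bsub>A\<^esub> x"
    by (rule quotient_epi[OF assms])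
  show ?thesis
  proof (rule Q.solvable_iff)
    fix x y
    assume x: "x \<in> carrier A" and y: "y \<in> carrier A"
      and "I +>\<^bsub>A\<^esub> x = \<zero>\<^bsub>quotient_algebra A I\<^esub>"
    then have "I +>\<^bsub>A\<^esub> x = I" by (simp add: quotient_algebra_def)
    then have "x \<in> I"
      using M.a_coset_join1[of I x] x I by (simp add: submodule_def)
    then show "x \<otimes>\<^bsub>A\<^esub> y = \<zero>\<^bsub>A\<^esub>" using central y by (auto simp: alg_center_def)
  qed
qed

end

text \<open>Regrouping for the commutator of two operators of the form \<open>L_a + R_b\<close>: the
  \<open>p\<close> terms come from one composite, the \<open>q\<close> terms from the other.\<close>

lemma (in abelian_group) four_differences:
  assumes "p\<^sub>1 \<in> carrier G" "p\<^sub>2 \<in> carrier G" "p\<^sub>3 \<in> carrier G" "p\<^sub>4 \<in> carrier G"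
    and "q\<^sub>1 \<in> carrier G" "q\<^sub>2 \<in> carrier G" "q\<^sub>3 \<in> carrier G" "q\<^sub>4 \<in> carrier G"
  shows "(p\<^sub>1 \<ominus> q\<^sub>1) \<ominus> (q\<^sub>3 \<ominus> p\<^sub>2) \<oplus> (p\<^sub>3 \<ominus> q\<^sub>2) \<oplus> (p\<^sub>4 \<ominus> q\<^sub>4) =
    (p\<^sub>1 \<oplus> p\<^sub>2 \<oplus> (p\<^sub>3 \<oplus> p\<^sub>4)) \<ominus> (q\<^sub>1 \<oplus> q\<^sub>2 \<oplus> (q\<^sub>3 \<oplus> q\<^sub>4))"
  using assms by (simp add: minus_eq minus_add a_ac)

section \<open>Consequences of the two Leibniz identities\<close>

context symmetric_leibniz_algebra
begin

text \<open>Insert the left identity for \<open>x(yz)\<close> into the right identity for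
  \<open>(xy)z\<close>; the term \<open>(xy)z\<close> cancels. As operators,
  \<open>L_(xz) = -R_(xz)\<close>.\<close>

lemma prod_swap:
  assumes x: "x \<in> carrier L" and z: "z \<in> carrier L" and y: "y \<in> carrier L"
  shows "(x \<otimes>\<^bsub>L\<^esub> z) \<otimes>\<^bsub>L\<^esub> y = \<ominus>\<^bsub>L\<^esub> (y \<otimes>\<^bsub>L\<^esub> (x \<otimes>\<^bsub>L\<^esub> z))"
proof -
  let ?p = "(x \<otimes>\<^bsub>L\<^esub> z) \<otimes>\<^bsub>L\<^esub> y" and ?q = "y \<otimes>\<^bsub>L\<^esub> (x \<otimes>\<^bsub>L\<^esub> z)" and ?r = "(x \<otimes>\<^bsub>L\<^esub> y) \<otimes>\<^bsub>L\<^esub> z"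
  have cl: "?p \<in> carrier L" "?q \<in> carrier L" "?r \<in> carrier L"
    using assms by (simp_all add: prod_closed)
  have "?r = ?p \<oplus>\<^bsub>L\<^esub> (?r \<oplus>\<^bsub>L\<^esub> ?q)"
    using right_leibniz[OF x y z] left_leibniz[OF x y z] by simp
  then have "?r \<oplus>\<^bsub>L\<^esub> (?p \<oplus>\<^bsub>L\<^esub> ?q) = ?r"
    using cl by (simp add: M.a_ac)
  then have "?p \<oplus>\<^bsub>L\<^esub> ?q = \<zero>\<^bsub>L\<^esub>"
    using cl by (simp add: M.add.l_cancel_one)
  then show ?thesis
    by (rule M.minus_equality[OF _ cl(2,1), symmetric])
qed

text \<open>The left identity at \<open>x, x, y\<close> reads \<open>x(xy) = (xx)y + x(xy)\<close>,
  and the right identity at \<open>y, x, x\<close> reads \<open>(yx)x = (yx)x + y(xx)\<close>.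
  Cancelling kills both products with \<open>xx\<close>.\<close>

lemma square_central:
  assumes x: "x \<in> carrier L"
  shows "x \<otimes>\<^bsub>L\<^esub> x \<in> alg_center L"
proof -
  have "(x \<otimes>\<^bsub>L\<^esub> x) \<otimes>\<^bsub>L\<^esub> y = \<zero>\<^bsub>L\<^esub> \<and> y \<otimes>\<^bsub>L\<^esub> (x \<otimes>\<^bsub>L\<^esub> x) = \<zero>\<^bsub>L\<^esub>" if y: "y \<in> carrier L" for y
    using left_leibniz[OF x x y] right_leibniz[OF y x x] x y
    by (simp add: prod_closed M.add.l_cancel_one' M.add.r_cancel_one')
  then show ?thesis using x by (simp add: alg_center_def prod_closed)
qed

lemma leibniz_kernel_submodule: "submodule (leibniz_kernel F L) F L"
  unfolding leibniz_kernel_def by (rule lin_span_submodule) (auto simp: prod_closed)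

lemma leibniz_kernel_central: "leibniz_kernel F L \<subseteq> alg_center L"
  unfolding leibniz_kernel_def
  by (rule lin_span_least[OF alg_center_submodule]) (auto simp: square_central)

text \<open>The left identity rearranged: \<open>[L_a, L_b] = L_(ab)\<close>.\<close>

lemma left_left_commutator:
  assumes "a \<in> carrier L" "b \<in> carrier L" "x \<in> carrier L"
  shows "a \<otimes>\<^bsub>L\<^esub> (b \<otimes>\<^bsub>L\<^esub> x) \<ominus>\<^bsub>L\<^esub> b \<otimes>\<^bsub>L\<^esub> (a \<otimes>\<^bsub>L\<^esub> x) = (a \<otimes>\<^bsub>L\<^esub> b) \<otimes>\<^bsub>L\<^esub> x"
  using assms left_leibniz[of a b x]
  by (simp add: prod_closed M.minus_eq M.a_assoc M.r_neg)

text \<open>The right identity rearranged: \<open>[R_b, L_a] = L_(ab)\<close>.\<close>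

lemma left_right_commutator:
  assumes "a \<in> carrier L" "b \<in> carrier L" "x \<in> carrier L"
  shows "(a \<otimes>\<^bsub>L\<^esub> x) \<otimes>\<^bsub>L\<^esub> b \<ominus>\<^bsub>L\<^esub> a \<otimes>\<^bsub>L\<^esub> (x \<otimes>\<^bsub>L\<^esub> b) = (a \<otimes>\<^bsub>L\<^esub> b) \<otimes>\<^bsub>L\<^esub> x"
  using assms right_leibniz[of a x b]
  by (simp add: prod_closed M.minus_eq M.a_assoc M.r_neg)

text \<open>The right identity again, with reversed order of factors:
  \<open>[R_a, R_b] = R_(ba)\<close>.\<close>

lemma right_right_commutator:
  assumes "a \<in> carrier L" "b \<in> carrier L" "x \<in> carrier L"
  shows "(x \<otimes>\<^bsub>L\<^esub> b) \<otimes>\<^bsub>L\<^esub> a \<ominus>\<^bsub>L\<^esub> (x \<otimes>\<^bsub>L\<^esub> a) \<otimes>\<^bsub>L\<^esub> b = x \<otimes>\<^bsub>L\<^esub> (b \<otimes>\<^bsub>L\<^esub> a)"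
  using assms right_leibniz[of x b a]
  by (simp add: prod_closed M.minus_eq M.a_comm[of _ "x \<otimes>\<^bsub>L\<^esub> (b \<otimes>\<^bsub>L\<^esub> a)"] M.a_assoc M.r_neg)

section \<open>Left and right multiplications as images of the algebra\<close>

lemma left_mult_epi: "algebra_epi F L (gl_sub F L (left_mults L)) (left_mult L)"
  by unfold_locales
    (auto simp: left_mults_def left_mult_def prod_closed prod_add_left prod_smult_left
      left_left_commutator cong: restrict_cong)

text \<open>The sign repairs the reversed order:
  \<open>[-R_a, -R_b] = R_(ba) = -R_(ab)\<close>.\<close>

lemma right_mult_epi: "algebra_epi F L (gl_sub F L (right_mults L)) (\<lambda>a. right_mult L (\<ominus>\<^bsub>L\<^esub> a))"
proof
  have "right_mult L a \<in> (\<lambda>a. right_mult L (\<ominus>\<^bsub>L\<^esub> a)) ` carrier L" if "a \<in> carrier L" for a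
    using that by (intro image_eqI[where x = "\<ominus>\<^bsub>L\<^esub> a"]) auto
  then show "(\<lambda>a. right_mult L (\<ominus>\<^bsub>L\<^esub> a)) ` carrier L = carrier (gl_sub F L (right_mults L))"
    by (auto simp: right_mults_def)
  fix a b assume ab: "a \<in> carrier L" "b \<in> carrier L"
  \<comment> \<open>Exchanging \<open>a\<close> and \<open>b\<close> in
    \<open>right_right_commutator\<close> negates its left side, hence also its right side.\<close>
  have "x \<otimes>\<^bsub>L\<^esub> (a \<otimes>\<^bsub>L\<^esub> b) = \<ominus>\<^bsub>L\<^esub> (x \<otimes>\<^bsub>L\<^esub> (b \<otimes>\<^bsub>L\<^esub> a))" if x: "x \<in> carrier L" for x
    using ab x right_right_commutator[of a b x] right_right_commutator[of b a x]
    by (metis M.minus_eq M.minus_add M.minus_minus M.a_comm M.a_inv_closed prod_closed)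
  then show "right_mult L (\<ominus>\<^bsub>L\<^esub> (a \<otimes>\<^bsub>L\<^esub> b)) =
      right_mult L (\<ominus>\<^bsub>L\<^esub> a) \<otimes>\<^bsub>gl_sub F L (right_mults L)\<^esub> right_mult L (\<ominus>\<^bsub>L\<^esub> b)"
    using ab by (auto simp: right_mult_def prod_closed prod_minus minus_prod
        right_right_commutator cong: restrict_cong)
qed (auto simp: right_mult_def prod_closed prod_add_right prod_smult_right M.minus_add
    prod_minus smult_r_minus cong: restrict_cong)

text \<open>As an epimorphic image of \<open>L\<close> this set is a module under the operations of
  \<open>gl\<close> and is closed under commutators.\<close>

lemma left_mults_subalgebra: "subalgebra_of (left_mults L) F (gl F L)"
proof -
  interpret E: algebra_epi F L "gl_sub F L (left_mults L)" "left_mult L"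
    by (rule left_mult_epi)
  interpret gl: module F "gl F L" by (rule gl_module)
  have "left_mults L \<subseteq> carrier (gl F L)" by (auto simp: left_mults_def left_mult_linear)
  then show ?thesis
    using gl.module_incl_imp_submodule[OF _ E.module_image] E.image_prod_closed
    by (simp add: subalgebra_of_def)
qed

text \<open>The kernel has zero product: if \<open>L_x\<close> is zero, evaluating it at
  \<open>y\<close> gives \<open>xy = 0\<close>.\<close>

lemma left_mults_solvable_iff:
  "solvable_algebra F L \<longleftrightarrow> solvable_algebra F (gl_sub F L (left_mults L))"
proof -
  interpret E: algebra_epi F L "gl_sub F L (left_mults L)" "left_mult L"
    by (rule left_mult_epi)
  show ?thesis
  proof (rule E.solvable_iff)
    fix x y
    assume "y \<in> carrier L" "left_mult L x = \<zero>\<^bsub>gl_sub F L (left_mults L)\<^esub>"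
    then show "x \<otimes>\<^bsub>L\<^esub> y = \<zero>\<^bsub>L\<^esub>"
      by (auto simp: left_mult_def dest: fun_cong[of _ _ y])
  qed
qed

text \<open>Here the second factor acts: if \<open>R_(-y)\<close> is zero, evaluating it at
  \<open>x\<close> gives \<open>-(xy) = 0\<close>.\<close>

lemma right_mults_solvable_iff:
  "solvable_algebra F L \<longleftrightarrow> solvable_algebra F (gl_sub F L (right_mults L))"
proof -
  interpret E: algebra_epi F L "gl_sub F L (right_mults L)" "\<lambda>a. right_mult L (\<ominus>\<^bsub>L\<^esub> a)"
    by (rule right_mult_epi)
  show ?thesis
  proof (rule E.solvable_iff)
    fix x y
    assume xy: "x \<in> carrier L" "y \<in> carrier L"
      and "right_mult L (\<ominus>\<^bsub>L\<^esub> y) = \<zero>\<^bsub>gl_sub F L (right_mults L)\<^esub>"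
    then have "\<ominus>\<^bsub>L\<^esub> (x \<otimes>\<^bsub>L\<^esub> y) = \<zero>\<^bsub>L\<^esub>"
      by (auto simp: right_mult_def prod_minus dest: fun_cong[of _ _ x])
    then show "x \<otimes>\<^bsub>L\<^esub> y = \<zero>\<^bsub>L\<^esub>"
      using xy by (simp add: prod_closed M.add.inv_eq_1_iff)
  qed
qed

section \<open>The Lie multiplication algebra\<close>

text \<open>An explicit subspace that will be shown to be a subalgebra containing all generators,
  hence all of \<open>Lie(L)\<close>. It spares an induction over iterated commutators.\<close>

definition mult_sums :: "('c \<Rightarrow> 'c) set" where
  "mult_sums = {left_mult L a \<oplus>\<^bsub>gl F L\<^esub> right_mult L b | a b. a \<in> carrier L \<and> b \<in> carrier L}"

lemma mult_sums_alt:
  "mult_sums = {\<lambda>x\<in>carrier L. a \<otimes>\<^bsub>L\<^esub> x \<oplus>\<^bsub>L\<^esub> x \<otimes>\<^bsub>L\<^esub> b | a b. a \<in> carrier L \<and> b \<in> carrier L}"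
  by (simp add: mult_sums_def left_mult_def right_mult_def cong: restrict_cong)

lemma mult_sumsI:
  assumes "a \<in> carrier L" "b \<in> carrier L"
    and "\<And>x. x \<in> carrier L \<Longrightarrow> f x = a \<otimes>\<^bsub>L\<^esub> x \<oplus>\<^bsub>L\<^esub> x \<otimes>\<^bsub>L\<^esub> b"
  shows "(\<lambda>x\<in>carrier L. f x) \<in> mult_sums"
  using assms unfolding mult_sums_alt by (auto cong: restrict_cong)

text \<open>Bilinear expansion of \<open>[L_a + R_b, L_c + R_d]\<close> gives
  \<open>L_(ac) - L_(ad) + L_(cb) + R_(db)\<close>, and \<open>R_(db) = -L_(db)\<close> by
  \<open>prod_swap\<close>.\<close>

lemma commutator_in_left_mults:
  assumes "f \<in> mult_sums" "g \<in> mult_sums"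
  shows "f \<otimes>\<^bsub>gl F L\<^esub> g \<in> left_mults L"
proof -
  obtain a b c d where abcd: "a \<in> carrier L" "b \<in> carrier L" "c \<in> carrier L" "d \<in> carrier L"
    and f: "f = (\<lambda>x\<in>carrier L. a \<otimes>\<^bsub>L\<^esub> x \<oplus>\<^bsub>L\<^esub> x \<otimes>\<^bsub>L\<^esub> b)"
    and g: "g = (\<lambda>x\<in>carrier L. c \<otimes>\<^bsub>L\<^esub> x \<oplus>\<^bsub>L\<^esub> x \<otimes>\<^bsub>L\<^esub> d)"
    using assms unfolding mult_sums_alt by auto
  \<comment> \<open>The sum of the four indices, with the sign of \<open>db\<close> coming from
    \<open>prod_swap\<close>.\<close>
  let ?e = "a \<otimes>\<^bsub>L\<^esub> c \<ominus>\<^bsub>L\<^esub> a \<otimes>\<^bsub>L\<^esub> d \<oplus>\<^bsub>L\<^esub> c \<otimes>\<^bsub>L\<^esub> b \<ominus>\<^bsub>L\<^esub> d \<otimes>\<^bsub>L\<^esub> b"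
  have "f \<otimes>\<^bsub>gl F L\<^esub> g = left_mult L ?e"
    unfolding left_mult_def gl_simps
  proof (rule restrict_ext)
    fix x assume x: "x \<in> carrier L"
    have "?e \<otimes>\<^bsub>L\<^esub> x = (a \<otimes>\<^bsub>L\<^esub> c) \<otimes>\<^bsub>L\<^esub> x \<ominus>\<^bsub>L\<^esub> (a \<otimes>\<^bsub>L\<^esub> d) \<otimes>\<^bsub>L\<^esub> x \<oplus>\<^bsub>L\<^esub> (c \<otimes>\<^bsub>L\<^esub> b) \<otimes>\<^bsub>L\<^esub> x
        \<oplus>\<^bsub>L\<^esub> x \<otimes>\<^bsub>L\<^esub> (d \<otimes>\<^bsub>L\<^esub> b)"
      using abcd x by (simp add: prod_add_left minus_prod prod_closed M.minus_eq prod_swap[of d b x])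
    \<comment> \<open>Each of the four terms is unfolded into its commutator; the eight resulting
      terms are then regrouped into the two composites.\<close>
    also have "\<dots> = f (g x) \<ominus>\<^bsub>L\<^esub> g (f x)"
      unfolding left_left_commutator[OF abcd(1,3) x, symmetric]
        left_right_commutator[OF abcd(1,4) x, symmetric]
        left_right_commutator[OF abcd(3,2) x, symmetric]
        right_right_commutator[OF abcd(2,4) x, symmetric]
      by (subst M.four_differences)
        (use abcd x in \<open>simp_all add: f g prod_add_left prod_add_right prod_closed\<close>)
    finally show "f (g x) \<ominus>\<^bsub>L\<^esub> g (f x) = ?e \<otimes>\<^bsub>L\<^esub> x" by simp
  qed
  then show ?thesis
    using abcd by (simp add: left_mults_def prod_closed del: gl_simps)
qed

lemma left_mults_subset_mult_sums: "left_mults L \<subseteq> mult_sums"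
  unfolding left_mults_def left_mult_def
  by (auto intro!: mult_sumsI[where b = "\<zero>\<^bsub>L\<^esub>"] simp: prod_closed)

lemma right_mults_subset_mult_sums: "right_mults L \<subseteq> mult_sums"
  unfolding right_mults_def right_mult_def
  by (auto intro!: mult_sumsI[where a = "\<zero>\<^bsub>L\<^esub>"] simp: prod_closed)

text \<open>Sums and multiples act on the coefficients \<open>a\<close> and \<open>b\<close>;
  commutators even land in \<open>left_mults L\<close>, the case \<open>b = 0\<close>.\<close>

lemma mult_sums_subalgebra: "subalgebra_of mult_sums F (gl F L)"
proof -
  interpret gl: module F "gl F L" by (rule gl_module)
  have "submodule mult_sums F (gl F L)"
  proof (rule gl.submoduleI_smult)
    show "mult_sums \<subseteq> carrier (gl F L)"
      using gl.a_closed
      by (auto simp: mult_sums_def left_mult_linear right_mult_linear simp del: gl_simps(2-))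
    show "\<zero>\<^bsub>gl F L\<^esub> \<in> mult_sums"
      by (auto intro!: mult_sumsI[of "\<zero>\<^bsub>L\<^esub>" "\<zero>\<^bsub>L\<^esub>"])
  next
    fix f g assume "f \<in> mult_sums" "g \<in> mult_sums"
    then obtain a b c d where abcd: "a \<in> carrier L" "b \<in> carrier L" "c \<in> carrier L" "d \<in> carrier L"
      and "f = (\<lambda>x\<in>carrier L. a \<otimes>\<^bsub>L\<^esub> x \<oplus>\<^bsub>L\<^esub> x \<otimes>\<^bsub>L\<^esub> b)"
        "g = (\<lambda>x\<in>carrier L. c \<otimes>\<^bsub>L\<^esub> x \<oplus>\<^bsub>L\<^esub> x \<otimes>\<^bsub>L\<^esub> d)"
      unfolding mult_sums_alt by auto
    then show "f \<oplus>\<^bsub>gl F L\<^esub> g \<in> mult_sums"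
      by (auto intro!: mult_sumsI[of "a \<oplus>\<^bsub>L\<^esub> c" "b \<oplus>\<^bsub>L\<^esub> d"]
          simp: prod_add_left prod_add_right prod_closed M.a_ac)
  next
    fix k f assume k: "k \<in> carrier F" and "f \<in> mult_sums"
    then obtain a b where "a \<in> carrier L" "b \<in> carrier L"
      "f = (\<lambda>x\<in>carrier L. a \<otimes>\<^bsub>L\<^esub> x \<oplus>\<^bsub>L\<^esub> x \<otimes>\<^bsub>L\<^esub> b)"
      unfolding mult_sums_alt by auto
    then show "k \<odot>\<^bsub>gl F L\<^esub> f \<in> mult_sums"
      using k by (auto intro!: mult_sumsI[of "k \<odot>\<^bsub>L\<^esub> a" "k \<odot>\<^bsub>L\<^esub> b"]
          simp: prod_smult_left prod_smult_right smult_r_distr prod_closed)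
  qed
  then show ?thesis
    using commutator_in_left_mults left_mults_subset_mult_sums
    by (auto simp: subalgebra_of_def simp del: gl_simps)
qed

lemma lie_multiplications_subset: "lie_multiplications F L \<subseteq> mult_sums"
  using mult_sums_subalgebra left_mults_subset_mult_sums right_mults_subset_mult_sums
  by (auto simp: lie_multiplications_def generated_subalgebra_def)

lemma lie_multiplications_subalgebra: "subalgebra_of (lie_multiplications F L) F (gl F L)"
  unfolding lie_multiplications_def
  by (rule generated_subalgebra_subalgebra)
    (auto simp: left_mults_def right_mults_def left_mult_linear right_mult_linear)

text \<open>The derived series of the two algebras interleave: with \<open>G\<close> the Lie
  multiplication algebra and \<open>M\<close> the left multiplications, \<open>G^(n+1)\<close> lies
  in \<open>M^(n)\<close>, which lies in \<open>G^(n)\<close>.\<close>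

lemma lie_multiplications_solvable_iff:
  "solvable_algebra F (gl_sub F L (left_mults L)) \<longleftrightarrow>
    solvable_algebra F (gl_sub F L (lie_multiplications F L))"
proof -
  let ?M = "left_mults L" and ?G = "lie_multiplications F L"
  note M = left_mults_subalgebra and G = lie_multiplications_subalgebra
  interpret gl: module F "gl F L" by (rule gl_module)
  interpret G: module F "gl_sub F L ?G" by (rule gl_subalgebraD(1)[OF G])
  have MG: "?M \<subseteq> ?G" by (auto simp: lie_multiplications_def generated_subalgebra_def)
  have comm: "f \<otimes>\<^bsub>gl F L\<^esub> g \<in> ?M" if "f \<in> ?G" "g \<in> ?G" for f g
    using that commutator_in_left_mults lie_multiplications_subset by blast
  \<comment> \<open>This is the start of the first chain: \<open>G^(1)\<close> lies in
    \<open>M^(0) = M\<close>, because \<open>M\<close> is a submodule of \<open>G\<close> containing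
    all commutators.\<close>
  have "lin_span F (gl_sub F L ?G) {f \<otimes>\<^bsub>gl F L\<^esub> g | f g. f \<in> ?G \<and> g \<in> ?G} \<subseteq> ?M"
    using M G MG comm
    by (intro lin_span_least)
      (auto simp: gl.submodule_carrier_update_iff subalgebra_of_def simp del: gl_simps)
  then have "derived_series F (gl_sub F L ?G) (1 + n) \<subseteq> derived_series F (gl_sub F L ?M) (0 + n)" for n
    by (intro gl.derived_series_carrier_update_mono[OF G M])
      (simp add: subspace_prod_def del: gl_simps)
  moreover have "derived_series F (gl_sub F L ?M) (0 + n) \<subseteq> derived_series F (gl_sub F L ?G) (0 + n)" for n
    using MG by (intro gl.derived_series_carrier_update_mono[OF M G]) simp
  ultimately show ?thesis
    unfolding gl_sub_solvable_iff[OF M] gl_sub_solvable_iff[OF G] add_0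
    by (blast intro: order_trans)
qed

end

theorem theorem6p3:
  fixes F :: "('f, 'm) ring_scheme" and L :: "('f, 'v, 'n) module_scheme"
  assumes "symmetric_leibniz_algebra F L"
  shows "(solvable_algebra F L \<longleftrightarrow> solvable_algebra F (quotient_algebra L (leibniz_kernel F L)))
       \<and> (solvable_algebra F L \<longleftrightarrow> solvable_algebra F (quotient_algebra L (alg_center L)))
       \<and> (solvable_algebra F L \<longleftrightarrow> solvable_algebra F (gl_sub F L (left_mults L)))
       \<and> (solvable_algebra F L \<longleftrightarrow> solvable_algebra F (gl_sub F L (right_mults L)))
       \<and> (solvable_algebra F L \<longleftrightarrow> solvable_algebra F (gl_sub F L (lie_multiplications F L)))"
proof -
  interpret symmetric_leibniz_algebra F L by (rule assms)
  show ?thesis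
    \<comment> \<open>Both quotients are by central subspaces, so one lemma covers them. The Lie
      multiplication algebra is reached through the left multiplications.\<close>
    using quotient_solvable_iff[OF leibniz_kernel_submodule leibniz_kernel_central]
      quotient_solvable_iff[OF alg_center_submodule subset_refl]
      left_mults_solvable_iff right_mults_solvable_iff lie_multiplications_solvable_iff
    by blast
qed

end
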